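(* Let $f:\mathbb{R}\to\mathbb{R}$ and $s_0\in\mathbb{R}$. Then $\widehat f$ is continuous at $s_0$ if and only if $\widehat f$ is quasi-uniformly continuous at $s_0$.
   Context: All integrals are Henstock--Kurzweil integrals; complex-valued functions are integrated by real and imaginary parts. The Fourier transform is $\widehat f(s)=\int_{-\infty}^\infty e^{-isx}f(x)\,dx$, which exists at $s$ if $x\mapsto e^{-isx}f(x)$ is Henstock--Kurzweil integrable on $\mathbb{R}$. Continuity of $\widehat f$ at $s_0$ is understood to include that $\widehat f$ exists in a neighbourhood of $s_0$. Definition (quasi-uniform continuity). Let $k$ be a (real- or complex-valued) function on $\mathbb{R}^2$. If $F(x):=\int_{-\infty}^\infty k(x,y)\,dy$ exists in a neighbourhood of $x_0\in\mathbb{R}$, then $F$ is quasi-uniformly continuous at $x_0$ if for all $\epsilon>0$ and $M>0$ there exist $m=m(x_0,\epsilon,M)\ge M$ and $\delta=\delta(x_0,\epsilon,M)>0$ such that if $|x-x_0|<\delta$ then $\left|\int_{|y|>m}k(x,y)\,dy\right|<\epsilon$. For $\widehat f$ this is applied with $k(s,x)=e^{-isx}f(x)$. *)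

theory Defs
  imports "HOL-Analysis.Analysis"
begin

(* The library integral is the Henstock-Kurzweil (gauge) integral. For complex integrands it
   coincides with integrating real and imaginary parts (has_integral_componentwise_iff). Over UNIV
   it is the limit of the integrals over [a, b] as a and b tend independently to -infinity and
   +infinity, which by Hake's theorem is the Henstock-Kurzweil integral on the extended line. *)

definition fourier_kernel :: "(real \<Rightarrow> real) \<Rightarrow> real \<Rightarrow> real \<Rightarrow> complex" where
  "fourier_kernel f s x = exp (- \<i> * of_real s * of_real x) * of_real (f x)"

definition fourier_exists_at :: "(real \<Rightarrow> real) \<Rightarrow> real \<Rightarrow> bool" where
  "fourier_exists_at f s \<longleftrightarrow> fourier_kernel f s integrable_on UNIV"

definition fourier :: "(real \<Rightarrow> real) \<Rightarrow> real \<Rightarrow> complex" where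
  "fourier f s = integral UNIV (fourier_kernel f s)"

(* isCont alone would also see the default value 0 of the integral where the transform
   does not exist, so existence near s0 is required separately. *)
definition fourier_continuous_at :: "(real \<Rightarrow> real) \<Rightarrow> real \<Rightarrow> bool" where
  "fourier_continuous_at f s0 \<longleftrightarrow>
     (\<forall>\<^sub>F s in nhds s0. fourier_exists_at f s) \<and> isCont (fourier f) s0"

(* A property of F(x) = integral of k x over the line, stated through its kernel k. The first
   conjunct is the existence of F near x0; it also makes the tail integrals exist there, and
   delta may always be shrunk so that only such x are involved. *)
definition quasi_uniformly_continuous_at ::
    "(real \<Rightarrow> real \<Rightarrow> 'a::banach) \<Rightarrow> real \<Rightarrow> bool" where
  "quasi_uniformly_continuous_at k x0 \<longleftrightarrow>
     (\<forall>\<^sub>F x in nhds x0. k x integrable_on UNIV) \<and>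
     (\<forall>\<epsilon>>0. \<forall>M>0. \<exists>m\<ge>M. \<exists>\<delta>>0. \<forall>x. \<bar>x - x0\<bar> < \<delta> \<longrightarrow>
        norm (integral {y. \<bar>y\<bar> > m} (k x)) < \<epsilon>)"

end

theory Submission imports Defs begin

text \<open>
  Write the transform at \<open>s\<close> as the integral over \<open>[-m, m]\<close> (the head) plus the integral over
  \<open>\<bar>x\<bar> > m\<close> (the tail). For fixed \<open>m\<close> the head is continuous at \<open>s0\<close>, with no uniformity in \<open>m\<close>.
  If the transform is continuous at \<open>s0\<close>, so is every tail; the tail at \<open>s0\<close> itself is small for
  some \<open>m \<ge> M\<close>, hence it stays small near \<open>s0\<close>, which is quasi-uniform continuity.
  Conversely, one \<open>m\<close> whose tails are small near \<open>s0\<close> gives continuity by a three-epsilon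
  argument.

  The only analytic point is the continuity of the head. Uniform convergence of
  \<open>exp (- \<i> s x)\<close> to \<open>exp (- \<i> s0 x)\<close> on \<open>[-m, m]\<close> is not enough, because \<open>f\<close> may be integrable
  only conditionally. What helps is that the factor \<open>exp (- \<i> (s - s0) x) - 1\<close> by which the kernel
  at \<open>s0\<close> is multiplied has Lipschitz constant \<open>\<bar>s - s0\<bar>\<close>, hence a variation on \<open>[-m, m]\<close> that
  tends to 0. A Lipschitz function is a difference of two increasing ones, so the second mean
  value theorem bounds the integral of a Lipschitz weight times \<open>g\<close> by the Lipschitz
  constant times the supremum of the integrals of \<open>g\<close> over subintervals
  (\<open>lipschitz_weight_real\<close>, \<open>lipschitz_weight_complex\<close>).
\<close>

section \<open>Lipschitz weights under the Henstock--Kurzweil integral\<close>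

text \<open>
  Both \<open>w x + L * (x - c)\<close> and \<open>L * (x - c)\<close> are increasing, and \<open>w\<close> is their difference. The
  second mean value theorem replaces an increasing weight by its two endpoint values, so each of
  the two integrals is controlled by those values and \<open>B\<close>. The zero \<open>c\<close> of \<open>w\<close> makes the endpoint
  values proportional to \<open>L\<close>.
\<close>
lemma lipschitz_weight_real:
  fixes g w :: "real \<Rightarrow> real"
  assumes g: "g integrable_on {a..b}"
    and w: "L-lipschitz_on {a..b} w"
    and c: "c \<in> {a..b}" "w c = 0"
    and B: "\<And>u v. a \<le> u \<Longrightarrow> v \<le> b \<Longrightarrow> \<bar>integral {u..v} g\<bar> \<le> B"
  shows "(\<lambda>x. w x * g x) integrable_on {a..b}"
    and "\<bar>integral {a..b} (\<lambda>x. w x * g x)\<bar> \<le> 6 * (b - a) * B * L"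
proof -
  have ab: "a \<le> b" using c by auto
  have L: "L \<ge> 0" using w by (rule lipschitz_on_nonneg)
  have B0: "B \<ge> 0" using B[of a a] ab by simp
  have monotone_weight: "(\<lambda>x. u x * g x) integrable_on {a..b} \<and>
        \<bar>integral {a..b} (\<lambda>x. u x * g x)\<bar> \<le> 2 * K * B"
    if mono: "\<And>x y. \<lbrakk>a \<le> x; x \<le> y; y \<le> b\<rbrakk> \<Longrightarrow> u x \<le> u y"
      and K: "\<And>x. x \<in> {a..b} \<Longrightarrow> \<bar>u x\<bar> \<le> K" for u K
  proof -
    obtain d where d: "d \<in> {a..b}"
      and I: "((\<lambda>x. u x * g x) has_integral (u a * integral {a..d} g + u b * integral {d..b} g)) {a..b}"
      using second_mean_value_theorem_full[where g = u, OF g ab mono] by blast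
    have "\<bar>u a * integral {a..d} g\<bar> \<le> K * B" "\<bar>u b * integral {d..b} g\<bar> \<le> K * B"
      unfolding abs_mult using d ab B0 by (auto intro!: mult_mono K B order_trans[OF _ K])
    then show ?thesis
      using I integral_unique[OF I] by (auto simp: has_integral_integrable abs_le_iff)
  qed
  have lip: "\<bar>w x - w y\<bar> \<le> L * \<bar>x - y\<bar>" if "x \<in> {a..b}" "y \<in> {a..b}" for x y
    using lipschitz_onD[OF w that] by (simp add: dist_real_def)
  have linear: "\<bar>L * (x - c)\<bar> \<le> L * (b - a)" if "x \<in> {a..b}" for x
    unfolding abs_mult using L c that by (auto intro!: mult_mono)
  have 1: "(\<lambda>x. L * (x - c) * g x) integrable_on {a..b} \<and>
        \<bar>integral {a..b} (\<lambda>x. L * (x - c) * g x)\<bar> \<le> 2 * (L * (b - a)) * B"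
    by (rule monotone_weight) (use L linear in \<open>auto intro!: mult_left_mono\<close>)
  have 2: "(\<lambda>x. (w x + L * (x - c)) * g x) integrable_on {a..b} \<and>
        \<bar>integral {a..b} (\<lambda>x. (w x + L * (x - c)) * g x)\<bar> \<le> 2 * (2 * (L * (b - a))) * B"
  proof (rule monotone_weight)
    fix x y assume "a \<le> x" "x \<le> y" "y \<le> b"
    then show "w x + L * (x - c) \<le> w y + L * (y - c)"
      using lip[of x y] by (auto simp: algebra_simps abs_le_iff)
  next
    fix x assume x: "x \<in> {a..b}"
    have "\<bar>w x\<bar> \<le> L * (b - a)"
      using lip[OF x c(1)] linear[OF x] c L by (simp add: abs_mult)
    then show "\<bar>w x + L * (x - c)\<bar> \<le> 2 * (L * (b - a))"
      using linear[OF x] by linarith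
  qed
  have eq: "(\<lambda>x. w x * g x) = (\<lambda>x. (w x + L * (x - c)) * g x - L * (x - c) * g x)"
    by (simp add: fun_eq_iff algebra_simps)
  show "(\<lambda>x. w x * g x) integrable_on {a..b}"
    unfolding eq using 1 2 by (intro integrable_diff) auto
  have "integral {a..b} (\<lambda>x. w x * g x) =
      integral {a..b} (\<lambda>x. (w x + L * (x - c)) * g x) - integral {a..b} (\<lambda>x. L * (x - c) * g x)"
    unfolding eq using 1 2 by (intro integral_diff) auto
  then have "\<bar>integral {a..b} (\<lambda>x. w x * g x)\<bar> \<le> 2 * (2 * (L * (b - a))) * B + 2 * (L * (b - a)) * B"
    using 1 2 by linarith
  then show "\<bar>integral {a..b} (\<lambda>x. w x * g x)\<bar> \<le> 6 * (b - a) * B * L"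
    by (simp add: algebra_simps)
qed

text \<open>
  The indefinite integral is continuous on a compact interval, hence bounded, even when \<open>g\<close> is not
  absolutely integrable.
\<close>
lemma bounded_subinterval_integrals:
  fixes g :: "real \<Rightarrow> 'a::banach"
  assumes g: "g integrable_on {a..b}"
  obtains B where "\<And>u v. a \<le> u \<Longrightarrow> v \<le> b \<Longrightarrow> norm (integral {u..v} g) \<le> B"
proof -
  have "bounded ((\<lambda>x. integral {a..x} g) ` {a..b})"
    by (intro compact_imp_bounded compact_continuous_image indefinite_integral_continuous_1 g) auto
  then obtain C where C: "C > 0" "\<And>x. x \<in> {a..b} \<Longrightarrow> norm (integral {a..x} g) \<le> C"
    by (auto simp: bounded_pos)
  have "norm (integral {u..v} g) \<le> 2 * C" if "a \<le> u" "v \<le> b" for u v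
  proof (cases "u \<le> v")
    case True
    have "integral {a..u} g + integral {u..v} g = integral {a..v} g"
      using that True by (intro Henstock_Kurzweil_Integration.integral_combine integrable_subinterval_real[OF g]) auto
    then have "integral {u..v} g = integral {a..v} g - integral {a..u} g"
      by (simp add: algebra_simps)
    then show ?thesis
      using C(2)[of u] C(2)[of v] that True
        norm_triangle_ineq4[of "integral {a..v} g" "integral {a..u} g"] by auto
  qed (use C in auto)
  then show thesis by (rule that)
qed

text \<open>
  The second mean value theorem is a statement about real functions, so the product is split into
  the four products of real and imaginary parts. The bound \<open>C\<close> depends on \<open>g\<close> alone: this is what
  allows the weight to vary and its Lipschitz constant to tend to 0.
\<close>
lemma lipschitz_weight_complex:
  fixes g :: "real \<Rightarrow> complex"
  assumes g: "g integrable_on {a..b}"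
  obtains C where "\<And>w L c. L-lipschitz_on {a..b} w \<Longrightarrow> c \<in> {a..b} \<Longrightarrow> w c = 0 \<Longrightarrow>
      norm (integral {a..b} (\<lambda>x. w x * g x)) \<le> C * L"
proof -
  have gr: "(\<lambda>x. Re (g x)) integrable_on {a..b}" and gi: "(\<lambda>x. Im (g x)) integrable_on {a..b}"
    using has_integral_Re has_integral_Im g unfolding integrable_on_def by blast+
  obtain B1 where B1: "\<And>u v. a \<le> u \<Longrightarrow> v \<le> b \<Longrightarrow> \<bar>integral {u..v} (\<lambda>x. Re (g x))\<bar> \<le> B1"
    using bounded_subinterval_integrals[OF gr] by (metis real_norm_def)
  obtain B2 where B2: "\<And>u v. a \<le> u \<Longrightarrow> v \<le> b \<Longrightarrow> \<bar>integral {u..v} (\<lambda>x. Im (g x))\<bar> \<le> B2"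
    using bounded_subinterval_integrals[OF gi] by (metis real_norm_def)
  define C where "C = 12 * (b - a) * (B1 + B2)"
  have "norm (integral {a..b} (\<lambda>x. w x * g x)) \<le> C * L"
    if w: "L-lipschitz_on {a..b} w" and c: "c \<in> {a..b}" "w c = 0" for w :: "real \<Rightarrow> complex" and L c
  proof -
    have wr: "L-lipschitz_on {a..b} (\<lambda>x. Re (w x))" and wi: "L-lipschitz_on {a..b} (\<lambda>x. Im (w x))"
      using w order_trans[OF abs_Re_le_cmod[of "w x - w y" for x y]]
        order_trans[OF abs_Im_le_cmod[of "w x - w y" for x y]]
      by (simp_all add: lipschitz_on_def dist_norm)
    have c0: "Re (w c) = 0" "Im (w c) = 0" using c by auto
    note rr = lipschitz_weight_real[OF gr wr c(1) c0(1) B1]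
    note ir = lipschitz_weight_real[OF gr wi c(1) c0(2) B1]
    note ri = lipschitz_weight_real[OF gi wr c(1) c0(1) B2]
    note ii = lipschitz_weight_real[OF gi wi c(1) c0(2) B2]
    let ?I = "\<lambda>p q. integral {a..b} (\<lambda>x. p (w x) * q (g x) :: real)"
    have re: "((\<lambda>x. Re (w x * g x)) has_integral (?I Re Re - ?I Im Im)) {a..b}"
      using has_integral_diff[OF rr(1)[THEN integrable_integral] ii(1)[THEN integrable_integral]] by simp
    have im: "((\<lambda>x. Im (w x * g x)) has_integral (?I Re Im + ?I Im Re)) {a..b}"
      using has_integral_add[OF ri(1)[THEN integrable_integral] ir(1)[THEN integrable_integral]] by simp
    have "((\<lambda>x. w x * g x) has_integral Complex (?I Re Re - ?I Im Im) (?I Re Im + ?I Im Re)) {a..b}"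
      using re im by (subst has_integral_componentwise_iff) (auto simp: Basis_complex_def)
    then have "norm (integral {a..b} (\<lambda>x. w x * g x)) \<le>
        \<bar>?I Re Re - ?I Im Im\<bar> + \<bar>?I Re Im + ?I Im Re\<bar>"
      using cmod_le[of "Complex (?I Re Re - ?I Im Im) (?I Re Im + ?I Im Re)"]
      by (simp add: integral_unique)
    also have "\<dots> \<le> 2 * (6 * (b - a) * B1 * L) + 2 * (6 * (b - a) * B2 * L)"
      using rr(2) ir(2) ri(2) ii(2) by linarith
    also have "\<dots> = C * L" by (simp add: C_def algebra_simps)
    finally show ?thesis .
  qed
  then show thesis by (rule that)
qed

section \<open>Continuity of the truncated transform\<close>

text \<open>
  A chord of the unit circle is no longer than its arc. Subtracting 1 makes the function vanish at
  0, as the estimates for Lipschitz weights require.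
\<close>
lemma lipschitz_imaginary_exp:
  "\<bar>h\<bar>-lipschitz_on S (\<lambda>x. exp (- \<i> * of_real h * of_real x) - 1)"
proof (rule lipschitz_onI)
  fix x y :: real
  let ?e = "\<lambda>x. exp (- \<i> * of_real h * of_real x)"
  have "?e x = ?e y * exp (\<i> * of_real (h * (y - x)))"
    unfolding exp_add[symmetric] by (simp add: algebra_simps)
  then have "?e x - ?e y = ?e y * (exp (\<i> * of_real (h * (y - x))) - 1)"
    by (simp add: algebra_simps)
  moreover have "norm (?e y) = 1"
    using norm_exp_i_times[of "- (h * y)"] by (simp add: algebra_simps)
  ultimately have "norm (?e x - ?e y) = 2 * \<bar>sin (h * (y - x) / 2)\<bar>"
    by (simp only: norm_mult dist_exp_i_1 mult_1)
  also have "\<dots> \<le> 2 * \<bar>h * (y - x) / 2\<bar>"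
    by (intro mult_left_mono abs_sin_x_le_abs_x) auto
  also have "\<dots> = \<bar>h\<bar> * \<bar>x - y\<bar>" by (simp add: abs_mult abs_minus_commute)
  finally show "dist (?e x - 1) (?e y - 1) \<le> \<bar>h\<bar> * dist x y"
    by (simp add: dist_norm)
qed simp

lemma fourier_kernel_shift:
  "fourier_kernel f s x = exp (- \<i> * of_real (s - s0) * of_real x) * fourier_kernel f s0 x"
proof -
  have "- \<i> * of_real s * of_real x = - \<i> * of_real (s - s0) * of_real x + - \<i> * of_real s0 * of_real x"
    by (simp add: algebra_simps)
  then show ?thesis
    unfolding fourier_kernel_def by (simp only: exp_add mult.assoc)
qed

lemma integrable_on_Icc_of_UNIV:
  fixes g :: "real \<Rightarrow> 'a::banach"
  assumes "g integrable_on UNIV"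
  shows "g integrable_on {a..b}"
  using integrable_on_subcbox[OF assms, of a b] by simp

text \<open>
  The difference of the truncated transforms at \<open>s\<close> and \<open>s0\<close> is the integral of the kernel at \<open>s0\<close>
  against the weight \<open>exp (- \<i> (s - s0) x) - 1\<close>, hence at most a constant times \<open>\<bar>s - s0\<bar>\<close>.
\<close>
lemma isCont_truncated_fourier:
  fixes m :: real
  assumes ex: "\<forall>\<^sub>F s in nhds s0. fourier_exists_at f s" and m: "m \<ge> 0"
  shows "isCont (\<lambda>s. integral {-m..m} (fourier_kernel f s)) s0"
proof -
  let ?G = "\<lambda>s. integral {-m..m} (fourier_kernel f s)"
  have int: "fourier_kernel f s integrable_on {-m..m}" if "fourier_exists_at f s" for s
    using that integrable_on_Icc_of_UNIV by (auto simp: fourier_exists_at_def)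
  have int0: "fourier_kernel f s0 integrable_on {-m..m}"
    using int eventually_nhds_x_imp_x[OF ex] by blast
  obtain C where C: "\<And>w L c. L-lipschitz_on {-m..m} w \<Longrightarrow> c \<in> {-m..m} \<Longrightarrow> w c = 0 \<Longrightarrow>
      norm (integral {-m..m} (\<lambda>x. w x * fourier_kernel f s0 x)) \<le> C * L"
    using lipschitz_weight_complex[OF int0] by blast
  have "\<forall>\<^sub>F s in nhds s0. norm (?G s - ?G s0) \<le> C * \<bar>s - s0\<bar>"
    using ex
  proof eventually_elim
    case (elim s)
    have "?G s - ?G s0 = integral {-m..m} (\<lambda>x. fourier_kernel f s x - fourier_kernel f s0 x)"
      using int[OF elim] int0 by (simp add: integral_diff)
    also have "\<dots> = integral {-m..m}
        (\<lambda>x. (exp (- \<i> * of_real (s - s0) * of_real x) - 1) * fourier_kernel f s0 x)"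
      by (subst fourier_kernel_shift[of f s _ s0]) (simp add: algebra_simps)
    finally show ?case
      using C[OF lipschitz_imaginary_exp, of 0 "s - s0"] m by simp
  qed
  then have "\<forall>\<^sub>F s in at s0. norm (?G s - ?G s0) \<le> C * \<bar>s - s0\<bar>"
    by (simp add: eventually_at_filter eventually_mono)
  moreover have "((\<lambda>s. C * \<bar>s - s0\<bar>) \<longlongrightarrow> 0) (at s0)"
    by (auto intro!: tendsto_eq_intros)
  ultimately have "((\<lambda>s. ?G s - ?G s0) \<longlongrightarrow> 0) (at s0)"
    by (rule Lim_null_comparison)
  then show ?thesis
    by (simp add: isCont_def Lim_null[symmetric])
qed

section \<open>Tails\<close>

lemma integral_tail:
  fixes g :: "real \<Rightarrow> 'a::banach"
  assumes "g integrable_on UNIV"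
  shows "integral {y. \<bar>y\<bar> > m} g = integral UNIV g - integral {-m..m} g"
proof -
  have "{y. \<bar>y\<bar> > m} = UNIV - {-m..m}" by auto
  then show ?thesis
    using integral_setdiff[OF assms integrable_on_Icc_of_UNIV[OF assms], of "-m" m] by simp
qed

lemma small_tail:
  fixes g :: "real \<Rightarrow> 'a::banach"
  assumes g: "g integrable_on UNIV" and "e > 0"
  obtains m where "m \<ge> M" "norm (integral {y. \<bar>y\<bar> > m} g) < e"
proof -
  obtain B where "B > 0"
    and B: "\<And>a b. ball 0 B \<subseteq> cbox a b \<Longrightarrow> norm (integral (cbox a b) g - integral UNIV g) < e"
    using integrable_integral[OF g] \<open>e > 0\<close> unfolding has_integral_alt'[of g _ UNIV]
    by auto
  have "ball 0 B \<subseteq> cbox (- max M B) (max M B)"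
    by (auto simp: dist_real_def)
  from B[OF this] show thesis
    by (intro that[of "max M B"]) (simp_all only: integral_tail[OF g] norm_minus_commute max.cobounded1 cbox_interval)
qed

section \<open>Continuity and quasi-uniform continuity of the Fourier transform\<close>

theorem theorem5:
  fixes f :: "real \<Rightarrow> real" and s0 :: real
  shows "fourier_continuous_at f s0 \<longleftrightarrow> quasi_uniformly_continuous_at (fourier_kernel f) s0"
proof (cases "\<forall>\<^sub>F s in nhds s0. fourier_exists_at f s")
  case False
  then show ?thesis
    by (simp add: fourier_continuous_at_def quasi_uniformly_continuous_at_def fourier_exists_at_def)
next
  case ex: True
  let ?head = "\<lambda>m s. integral {-m..m} (fourier_kernel f s)"
  let ?tail = "\<lambda>m s. integral {y. \<bar>y\<bar> > m} (fourier_kernel f s)"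
  have split: "?tail m s = fourier f s - ?head m s" if "fourier_exists_at f s" for m s
    using that by (simp add: fourier_exists_at_def fourier_def integral_tail)
  have ex0: "fourier_exists_at f s0"
    using eventually_nhds_x_imp_x[OF ex] .
  have head: "isCont (?head m) s0" if "m > 0" for m
    using isCont_truncated_fourier[OF ex] that by simp
  have limit_nhds: "(g \<longlongrightarrow> g s0) (nhds s0)" if "isCont g s0" for g :: "real \<Rightarrow> 'b::real_normed_vector"
    using that by (simp add: isCont_def tendsto_at_iff_tendsto_nhds)
  have "isCont (fourier f) s0 \<longleftrightarrow>
    (\<forall>\<epsilon>>0. \<forall>M>0. \<exists>m\<ge>M. \<exists>\<delta>>0. \<forall>s. \<bar>s - s0\<bar> < \<delta> \<longrightarrow> norm (?tail m s) < \<epsilon>)"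
  proof (intro iffI allI impI)
    fix \<epsilon> M :: real
    assume cont: "isCont (fourier f) s0" and "\<epsilon> > 0" "M > 0"
    obtain m where m: "m \<ge> M" "norm (?tail m s0) < \<epsilon>"
      using small_tail[of "fourier_kernel f s0" \<epsilon> M] ex0 \<open>\<epsilon> > 0\<close>
      unfolding fourier_exists_at_def by blast
    have "isCont (\<lambda>s. norm (fourier f s - ?head m s)) s0"
      using cont head[of m] m \<open>M > 0\<close> by (intro continuous_intros) auto
    then have "\<forall>\<^sub>F s in nhds s0. norm (fourier f s - ?head m s) < \<epsilon>"
      using m(2) by (intro order_tendstoD(2)[OF limit_nhds]) (simp_all add: split[OF ex0])
    with ex have "\<forall>\<^sub>F s in nhds s0. norm (?tail m s) < \<epsilon>"
      by eventually_elim (simp add: split)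
    then show "\<exists>m\<ge>M. \<exists>\<delta>>0. \<forall>s. \<bar>s - s0\<bar> < \<delta> \<longrightarrow> norm (?tail m s) < \<epsilon>"
      using m(1) unfolding eventually_nhds_metric dist_real_def by blast
  next
    assume quc: "\<forall>\<epsilon>>0. \<forall>M>0. \<exists>m\<ge>M. \<exists>\<delta>>0. \<forall>s. \<bar>s - s0\<bar> < \<delta> \<longrightarrow> norm (?tail m s) < \<epsilon>"
    show "isCont (fourier f) s0"
      unfolding isCont_def
    proof (rule tendstoI)
      fix e :: real assume "e > 0"
      \<comment> \<open>Any positive lower bound for \<open>m\<close> would do: a single truncation suffices here.\<close>
      then obtain m \<delta> where m: "m \<ge> 1" and "\<delta> > 0"
        and small: "\<And>s. \<bar>s - s0\<bar> < \<delta> \<Longrightarrow> norm (?tail m s) < e / 3"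
        using quc[rule_format, of "e / 3" 1] by auto
      have "\<forall>\<^sub>F s in nhds s0. norm (?tail m s) < e / 3"
        using small \<open>\<delta> > 0\<close> unfolding eventually_nhds_metric dist_real_def by blast
      moreover have "\<forall>\<^sub>F s in nhds s0. dist (?head m s) (?head m s0) < e / 3"
        using m \<open>e > 0\<close> by (intro tendstoD[OF limit_nhds[OF head]]) auto
      ultimately have "\<forall>\<^sub>F s in nhds s0. dist (fourier f s) (fourier f s0) < e"
        using ex
      proof eventually_elim
        case (elim s)
        have "fourier f s - fourier f s0 = (?head m s - ?head m s0) + (?tail m s - ?tail m s0)"
          by (simp add: split[OF elim(3)] split[OF ex0])
        then show ?case
          using norm_triangle_ineq[of "?head m s - ?head m s0" "?tail m s - ?tail m s0"]
            norm_triangle_ineq4[of "?tail m s" "?tail m s0"] elim(1,2) small[of s0] \<open>\<delta> > 0\<close>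
          by (simp add: dist_norm)
      qed
      then show "\<forall>\<^sub>F s in at s0. dist (fourier f s) (fourier f s0) < e"
        by (simp add: eventually_at_filter eventually_mono)
    qed
  qed
  with ex show ?thesis
    by (simp add: fourier_continuous_at_def quasi_uniformly_continuous_at_def fourier_exists_at_def)
qed

end
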